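(* Let $(X_t)_{t\ge0}$ be a birth–death process on $\{0,1,\dots,n\}$ with birth rates $(\lambda_x)$, death rates $(\nu_x)$, and stationary distribution $\pi$. Assume that there exists $\rho>0$ such that $$\min_{x\in\{1,\dots,n-1\}}\min\{\lambda_{x-1}-\lambda_x,\ \nu_{x+1}-\nu_x\}\ge\rho.$$ If $f\in\mathrm{Lip}_d(\{0,1,\dots,n\})$, then for any $x\in\{0,1,\dots,n\}$, any $t>0$ and any $y>0$, $$\mathbb{P}_x\big(f(X_t)-\mathbb{E}_x[f(X_t)]\ge y\big)\le\exp\left(-\frac{y}{2\|f\|_{\mathrm{Lip}_d}}\log\left(1+\frac{2\rho y}{(1-e^{-2\rho t})(\lambda_0+\nu_n)\|f\|_{\mathrm{Lip}_d}}\right)\right).$$ As $t\to+\infty$, one obtains, under the stationary distribution $\pi$, for any $y>0$, $$\pi\big(f-\pi(f)\ge y\big)\le\exp\left(-\frac{y}{2\|f\|_{\mathrm{Lip}_d}}\log\left(1+\frac{2\rho y}{(\lambda_0+\nu_n)\|f\|_{\mathrm{Lip}_d}}\right)\right).$$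
   Context: The state space $\{0,1,\dots,n\}$ carries the metric $d(x,y)=|x-y|$. The birth–death process is the continuous-time Markov chain with generator $\mathcal{L}f(x)=\lambda_x(f(x+1)-f(x))+\nu_x(f(x-1)-f(x))$, where the rates are positive except $\nu_0=0$ and $\lambda_n=0$. $\mathbb{P}_x,\mathbb{E}_x$ refer to the process started at $x$. $\|f\|_{\mathrm{Lip}_d}=\sup_{x\ne y}|f(x)-f(y)|/|x-y|$, $\mathrm{Lip}_d(\{0,1,\dots,n\})$ is the set of real functions with finite $\|f\|_{\mathrm{Lip}_d}$, and $\pi(f)=\sum_x f(x)\pi(x)$. *)

theory Defs
  imports "HOL-Probability.Probability"
begin

subsection \<open>Lipschitz functions for the metric \<open>\<bar>x - y\<bar>\<close>\<close>

definition Lip_on :: "nat set \<Rightarrow> (nat \<Rightarrow> real) set" where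
  "Lip_on S = {f. bdd_above
    ((\<lambda>(x, y). \<bar>f x - f y\<bar> / \<bar>real x - real y\<bar>) ` {(x, y). x \<in> S \<and> y \<in> S \<and> x \<noteq> y})}"

text \<open>The supremum is meaningful only if \<open>f \<in> Lip_on S\<close> and \<open>S\<close> has at least two points.\<close>

definition Lip_norm :: "nat set \<Rightarrow> (nat \<Rightarrow> real) \<Rightarrow> real" where
  "Lip_norm S f = (SUP (x, y) \<in> {(x, y). x \<in> S \<and> y \<in> S \<and> x \<noteq> y}. \<bar>f x - f y\<bar> / \<bar>real x - real y\<bar>)"

subsection \<open>Continuous-time Markov chains on a finite state space\<close>

text \<open>\<open>M\<close> only provides the underlying measurable space; \<open>P x\<close> is the law started at \<open>x\<close>.
  Times are the nonnegative reals: \<open>X t\<close> is irrelevant for \<open>t < 0\<close>.\<close>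

definition natural_filtration :: "'a measure \<Rightarrow> (real \<Rightarrow> 'a \<Rightarrow> 's) \<Rightarrow> real \<Rightarrow> 'a measure" where
  "natural_filtration M X s = sigma (space M) {X u -` B \<inter> space M | u B. 0 \<le> u \<and> u \<le> s}"

locale finite_markov_chain =
  fixes S :: "'s set"
    and M :: "'a measure"
    and P :: "'s \<Rightarrow> 'a measure"
    and X :: "real \<Rightarrow> 'a \<Rightarrow> 's"
  assumes finite_states: "finite S"
    and prob_space_P: "x \<in> S \<Longrightarrow> prob_space (P x)"
    and sets_P: "x \<in> S \<Longrightarrow> sets (P x) = sets M"
    and measurable_X: "0 \<le> t \<Longrightarrow> X t \<in> measurable M (count_space S)"
    and start: "x \<in> S \<Longrightarrow> AE \<omega> in P x. X 0 \<omega> = x"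
    and markov: "\<lbrakk>x \<in> S; z \<in> S; 0 \<le> s; 0 \<le> t\<rbrakk> \<Longrightarrow>
      AE \<omega> in P x.
        real_cond_exp (P x) (natural_filtration M X s) (indicator {\<omega> \<in> space M. X (s + t) \<omega> = z}) \<omega>
          = \<P>(\<omega>' in P (X s \<omega>). X t \<omega>' = z)"

text \<open>The infinitesimal generator, as an operator on all functions on \<open>S\<close>.\<close>

definition has_generator ::
    "'s set \<Rightarrow> ('s \<Rightarrow> 'a measure) \<Rightarrow> (real \<Rightarrow> 'a \<Rightarrow> 's) \<Rightarrow> (('s \<Rightarrow> real) \<Rightarrow> 's \<Rightarrow> real) \<Rightarrow> bool" where
  "has_generator S P X L \<longleftrightarrow>
    (\<forall>g. \<forall>x\<in>S. ((\<lambda>t. ((\<integral>\<omega>. g (X t \<omega>) \<partial>P x) - g x) / t) \<longlongrightarrow> L g x) (at_right 0))"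

definition stationary_distribution ::
    "'s set \<Rightarrow> ('s \<Rightarrow> 'a measure) \<Rightarrow> (real \<Rightarrow> 'a \<Rightarrow> 's) \<Rightarrow> 's pmf \<Rightarrow> bool" where
  "stationary_distribution S P X \<pi> \<longleftrightarrow>
    set_pmf \<pi> \<subseteq> S \<and>
    (\<forall>t\<ge>0. \<forall>z\<in>S. (\<Sum>x\<in>S. pmf \<pi> x * \<P>(\<omega> in P x. X t \<omega> = z)) = pmf \<pi> z)"

subsection \<open>Birth-death processes\<close>

text \<open>The values \<open>f (0 - 1)\<close> (truncated subtraction) and \<open>f (n + 1)\<close> do not matter
  because \<open>death 0 = 0\<close> and \<open>birth n = 0\<close> below.\<close>

definition bd_generator ::
    "(nat \<Rightarrow> real) \<Rightarrow> (nat \<Rightarrow> real) \<Rightarrow> (nat \<Rightarrow> real) \<Rightarrow> nat \<Rightarrow> real" where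
  "bd_generator birth death f x =
    birth x * (f (x + 1) - f x) + death x * (f (x - 1) - f x)"

locale birth_death_process = finite_markov_chain "{0..n}" M P X
  for n :: nat
    and birth death :: "nat \<Rightarrow> real"
    and M :: "'a measure"
    and P :: "nat \<Rightarrow> 'a measure"
    and X :: "real \<Rightarrow> 'a \<Rightarrow> nat" +
  assumes birth_pos: "x < n \<Longrightarrow> 0 < birth x"
    and birth_top: "birth n = 0"
    and death_pos: "\<lbrakk>0 < x; x \<le> n\<rbrakk> \<Longrightarrow> 0 < death x"
    and death_bot: "death 0 = 0"
    and generator: "has_generator {0..n} P X (bd_generator birth death)"

end

theory Submission
  imports Defs
begin

text \<open>
  Write \<open>P\<^sub>t\<close> for the transition semigroup, \<open>h(u) = e\<^sup>u - u - 1\<close> and \<open>V = \<lambda>\<^sub>0 + \<nu>\<^sub>n\<close>.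
  The monotonicity of the rates makes \<open>P\<^sub>t\<close> a contraction of the Lipschitz seminorm with factor
  \<open>exp (-\<rho>t)\<close>. Together with \<open>h(au) \<le> a\<^sup>2 h(u)\<close> for \<open>0 \<le> a \<le> 1\<close> this makes the bound
  \<open>P\<^sub>t exp(g) \<le> exp (P\<^sub>t g + V (1 - exp (-2\<rho>t)) / (2\<rho>) h(\<parallel>g\<parallel>))\<close>
  stable under composition in \<open>t\<close>. Both estimates hold up to \<open>o(t)\<close> for small \<open>t\<close>, by the form of
  the generator, hence for every \<open>t\<close>. The tail bound is Markov's inequality with the exponent
  \<open>ln (1 + u) / \<parallel>f\<parallel>\<close>, and the stationary case is the limit \<open>t \<rightarrow> \<infinity>\<close>.
\<close>

subsection \<open>Exponential inequalities\<close>

text \<open>The function \<open>h\<close> of the overview; \<open>exp (C * exp_excess u)\<close> is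
  the Laplace transform at \<open>u\<close> of a centred Poisson variable of mean
  \<open>C\<close>.\<close>

definition exp_excess :: "real \<Rightarrow> real" where
  "exp_excess u = exp u - u - 1"

lemma exp_excess_nonneg: "0 \<le> exp_excess u"
  unfolding exp_excess_def using exp_ge_add_one_self[of u] by linarith

lemma exp_excess_mono:
  assumes "0 \<le> u" "u \<le> r"
  shows "exp_excess u \<le> exp_excess r"
proof (rule DERIV_nonneg_imp_nondecreasing[OF assms(2)])
  fix s assume "u \<le> s" "s \<le> r"
  then show "\<exists>y. (exp_excess has_real_derivative y) (at s) \<and> 0 \<le> y"
    using assms(1) unfolding exp_excess_def[abs_def]
    by (intro exI[of _ "exp s - 1"] conjI) (auto intro!: derivative_eq_intros)
qed

text \<open>The difference of the two sides, \<open>exp u - exp (- u) - 2 * u\<close>, vanishes at 0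
  and its derivative is a perfect square.\<close>

lemma exp_excess_minus_le:
  assumes "0 \<le> u"
  shows "exp_excess (- u) \<le> exp_excess u"
proof -
  have "(\<lambda>s::real. exp s - exp (- s) - 2 * s) 0 \<le> (\<lambda>s. exp s - exp (- s) - 2 * s) u"
  proof (rule DERIV_nonneg_imp_nondecreasing[OF assms])
    fix s :: real assume "0 \<le> s" "s \<le> u"
    have "exp s + exp (- s) - 2 = (exp (s / 2) - exp (- s / 2))\<^sup>2"
      by (simp add: power2_diff flip: exp_double exp_add)
    then have "0 \<le> exp s + exp (- s) - 2"
      by simp
    then show "\<exists>y. ((\<lambda>s. exp s - exp (- s) - 2 * s) has_real_derivative y) (at s) \<and> 0 \<le> y"
      by (intro exI[of _ "exp s + exp (- s) - 2"] conjI) (auto intro!: derivative_eq_intros)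
  qed
  then show ?thesis
    by (simp add: exp_excess_def)
qed

text \<open>Downward increments cost no more than upward ones of the same size, so one value of
  \<open>exp_excess\<close> serves births and deaths alike.\<close>

lemma exp_excess_abs_le:
  assumes "\<bar>u\<bar> \<le> r"
  shows "exp_excess u \<le> exp_excess r"
proof -
  have "exp_excess u \<le> exp_excess \<bar>u\<bar>"
    using exp_excess_minus_le[of "- u"] by (cases "0 \<le> u") auto
  also have "\<dots> \<le> exp_excess r"
    using assms by (intro exp_excess_mono) auto
  finally show ?thesis .
qed

text \<open>The power series of \<open>exp_excess\<close> starts at order two, whence the factor
  \<open>a^2\<close>. The proof differentiates in \<open>s\<close> instead and uses convexity of
  \<open>exp\<close> between 0 and \<open>s\<close>. The square turns a contraction by
  \<open>exp (- \<rho> * s)\<close> into the rate \<open>2 * \<rho>\<close> of the final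
  bound.\<close>

lemma exp_excess_scale:
  assumes "0 \<le> a" "a \<le> 1" "0 \<le> r"
  shows "exp_excess (a * r) \<le> a\<^sup>2 * exp_excess r"
proof -
  have "(\<lambda>s. a\<^sup>2 * exp_excess s - exp_excess (a * s)) 0
      \<le> (\<lambda>s. a\<^sup>2 * exp_excess s - exp_excess (a * s)) r"
  proof (rule DERIV_nonneg_imp_nondecreasing[OF assms(3)])
    fix s :: real assume "0 \<le> s" "s \<le> r"
    have "exp ((1 - a) *\<^sub>R 0 + a *\<^sub>R s) \<le> (1 - a) * exp 0 + a * exp s"
      using assms by (intro convex_onD[OF exp_convex]) auto
    then have "0 \<le> a * (a * (exp s - 1) - (exp (a * s) - 1))"
      using assms by (intro mult_nonneg_nonneg) (auto simp: algebra_simps)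
    then show "\<exists>y. ((\<lambda>s. a\<^sup>2 * exp_excess s - exp_excess (a * s)) has_real_derivative y) (at s)
        \<and> 0 \<le> y"
      unfolding exp_excess_def
      by (intro exI[of _ "a * (a * (exp s - 1) - (exp (a * s) - 1))"] conjI)
        (auto intro!: derivative_eq_intros simp: power2_eq_square algebra_simps)
  qed
  then show ?thesis
    by (simp add: exp_excess_def)
qed

text \<open>Equivalent to \<open>(1 + u) * ln (1 + u) - u \<ge> u / 2 * ln (1 + u)\<close>, which
  trades the Poisson rate function for the simpler exponent of the theorem. The derivative of the
  difference is \<open>ln (1 + s) + 1 / (1 + s) - 1\<close>.\<close>

lemma ln_one_plus_ge:
  fixes u :: real
  assumes "0 \<le> u"
  shows "2 * u \<le> (2 + u) * ln (1 + u)"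
proof -
  have "(\<lambda>s. (2 + s) * ln (1 + s) - 2 * s) 0 \<le> (\<lambda>s. (2 + s) * ln (1 + s) - 2 * s) u"
  proof (rule DERIV_nonneg_imp_nondecreasing[OF assms])
    fix s :: real assume s: "0 \<le> s" "s \<le> u"
    have "ln (1 / (1 + s)) \<le> 1 / (1 + s) - 1"
      using s by (intro ln_le_minus_one) simp
    then have "0 \<le> ln (1 + s) + (2 + s) / (1 + s) - 2"
      using s by (simp add: ln_div field_simps)
    then show "\<exists>y. ((\<lambda>s. (2 + s) * ln (1 + s) - 2 * s) has_real_derivative y) (at s) \<and> 0 \<le> y"
      using s
      by (intro exI[of _ "ln (1 + s) + (2 + s) / (1 + s) - 2"] conjI)
        (auto intro!: derivative_eq_intros)
  qed
  then show ?thesis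
    by simp
qed

lemma one_minus_exp_ge:
  fixes a :: real
  assumes "0 \<le> a"
  shows "a - a\<^sup>2 \<le> 1 - exp (- a)"
proof -
  have "exp (- a) \<le> 1 / (1 + a)"
    using assms exp_ge_add_one_self[of a] by (simp add: exp_minus field_simps)
  \<comment> \<open>This holds because \<open>(1 + a) * (1 - a + a^2) = 1 + a^3\<close>.\<close>
  also have "\<dots> \<le> 1 - a + a\<^sup>2"
    using assms by (simp add: field_simps power2_eq_square)
  finally show ?thesis
    by simp
qed

text \<open>Chernoff's method for a Poisson-type Laplace bound. Weights on a finite set are used so
  that transition probabilities and the stationary distribution are treated alike.\<close>

lemma poisson_tail:
  fixes p :: "'b \<Rightarrow> real"
  assumes "finite A" and p: "\<And>z. z \<in> A \<Longrightarrow> 0 \<le> p z"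
    and "0 < C" "0 < l" "0 < y"
    and laplace: "\<And>\<tau>. 0 < \<tau> \<Longrightarrow>
      (\<Sum>z\<in>A. p z * exp (\<tau> * (f z - m))) \<le> exp (C * exp_excess (\<tau> * l))"
  shows "sum p {z \<in> A. y \<le> f z - m} \<le> exp (- (y / (2 * l)) * ln (1 + y / (C * l)))"
proof -
  \<comment> \<open>\<open>\<tau>\<close> minimises
    \<open>C * exp_excess (\<tau> * l) - \<tau> * y\<close>: the derivative vanishes where
    \<open>exp (\<tau> * l) = 1 + u\<close>.\<close>
  define u where "u = y / (C * l)"
  define \<tau> where "\<tau> = ln (1 + u) / l"
  have u: "0 < u" and y: "y = u * C * l"
    using assms by (simp_all add: u_def)
  have \<tau>: "0 < \<tau>" "\<tau> * l = ln (1 + u)" "\<tau> * y = u * C * ln (1 + u)"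
    using assms(4) u by (simp_all add: \<tau>_def y)
  have "sum p {z \<in> A. y \<le> f z - m}
      \<le> (\<Sum>z | z \<in> A \<and> y \<le> f z - m. exp (- (\<tau> * y)) * (p z * exp (\<tau> * (f z - m))))"
  proof (rule sum_mono)
    fix z assume z: "z \<in> {z \<in> A. y \<le> f z - m}"
    then have "p z * 1 \<le> p z * exp (\<tau> * (f z - m) - \<tau> * y)"
      using p \<tau>(1) by (intro mult_left_mono) auto
    then show "p z \<le> exp (- (\<tau> * y)) * (p z * exp (\<tau> * (f z - m)))"
      by (simp add: exp_diff exp_minus divide_inverse mult_ac)
  qed
  also have "\<dots> \<le> (\<Sum>z\<in>A. exp (- (\<tau> * y)) * (p z * exp (\<tau> * (f z - m))))"
    using p \<open>finite A\<close> by (intro sum_mono2) auto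
  also have "\<dots> \<le> exp (- (\<tau> * y)) * exp (C * exp_excess (\<tau> * l))"
    unfolding sum_distrib_left[symmetric] using laplace[OF \<tau>(1)] by (intro mult_left_mono) auto
  also have "\<dots> = exp (- (C * ((1 + u) * ln (1 + u) - u)))"
    using u by (simp add: \<tau> exp_excess_def flip: exp_add) (simp add: algebra_simps)
  also have "\<dots> \<le> exp (- (C * (u / 2 * ln (1 + u))))"
    using ln_one_plus_ge[of u] u \<open>0 < C\<close>
    by (intro iffD2[OF exp_le_cancel_iff] le_imp_neg_le mult_left_mono) (auto simp: algebra_simps)
  also have "- (C * (u / 2 * ln (1 + u))) = - (y / (2 * l)) * ln (1 + u)"
    using \<open>0 < l\<close> by (simp add: y)
  finally show ?thesis
    by (simp add: u_def)
qed

section \<open>From small times to all times\<close>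

text \<open>Cut \<open>t\<close> into \<open>N\<close> equal steps, each short enough for
  \<open>Q\<close>, and add them up. This stands in for integrating a differential inequality in
  time.\<close>

lemma additive_property_at_right_imp_all:
  assumes "eventually Q (at_right (0::real))"
    and add: "\<And>s t. \<lbrakk>0 < s; 0 < t; Q s; Q t\<rbrakk> \<Longrightarrow> Q (s + t)"
    and "0 < t"
  shows "Q t"
proof -
  obtain b where b: "0 < b" "\<And>s. 0 < s \<Longrightarrow> s < b \<Longrightarrow> Q s"
    using assms(1) unfolding eventually_at_right_field by auto
  obtain N where N: "t / b < real N"
    using reals_Archimedean2 by blast
  have "0 < t / b"
    using b assms by simp
  with N have "N > 0"
    by linarith
  define h where "h = t / real N"
  have h: "0 < h" "h < b"
    using N b \<open>N > 0\<close> \<open>0 < t\<close> by (auto simp: h_def field_simps)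
  \<comment> \<open>\<open>Suc k\<close> keeps the times positive: \<open>add\<close> says nothing
    about time 0.\<close>
  have "Q (real (Suc k) * h)" for k
  proof (induction k)
    case 0
    then show ?case using b h by simp
  next
    case (Suc k)
    have "Q (real (Suc k) * h + h)"
      using Suc h b by (intro add) auto
    then show ?case by (simp add: algebra_simps)
  qed
  from this[of "N - 1"] show ?thesis
    using \<open>N > 0\<close> by (simp add: h_def)
qed

subsection \<open>Lipschitz functions on an integer interval\<close>

text \<open>Along an integer interval, a bound on the increments between neighbours is the same as
  \<open>r\<close>-Lipschitz continuity for the distance. A free bound \<open>r\<close> instead of
  the supremum can be scaled and passed to limits.\<close>

definition lip_steps :: "nat \<Rightarrow> (nat \<Rightarrow> real) \<Rightarrow> real \<Rightarrow> bool" where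
  "lip_steps n g r \<longleftrightarrow> (\<forall>x<n. \<bar>g (Suc x) - g x\<bar> \<le> r)"

lemma lip_stepsI: "(\<And>x. x < n \<Longrightarrow> \<bar>g (Suc x) - g x\<bar> \<le> r) \<Longrightarrow> lip_steps n g r"
  by (simp add: lip_steps_def)

lemma lip_stepsD: "lip_steps n g r \<Longrightarrow> x < n \<Longrightarrow> \<bar>g (Suc x) - g x\<bar> \<le> r"
  by (simp add: lip_steps_def)

text \<open>Telescoping along the path between the points. The crude factor \<open>n\<close> is good
  enough, since the bound serves only for error terms that vanish in a limit and for the case
  \<open>r = 0\<close>.\<close>

lemma lip_steps_dist:
  assumes g: "lip_steps n g r" and "0 \<le> r" "x \<le> n" "y \<le> n"
  shows "\<bar>g y - g x\<bar> \<le> real n * r"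
proof -
  have *: "\<bar>g (a + k) - g a\<bar> \<le> real k * r" if "a + k \<le> n" for a k
    using that
  proof (induction k)
    case (Suc k)
    then have "\<bar>g (a + k) - g a\<bar> \<le> real k * r" "\<bar>g (Suc (a + k)) - g (a + k)\<bar> \<le> r"
      using lip_stepsD[OF g, of "a + k"] by auto
    then show ?case
      by (simp add: algebra_simps abs_le_iff)
  qed simp
  have **: "\<bar>g b - g a\<bar> \<le> real n * r" if "a \<le> b" "b \<le> n" for a b
  proof -
    have "\<bar>g b - g a\<bar> \<le> real (b - a) * r"
      using *[of a "b - a"] that by simp
    also have "\<dots> \<le> real n * r"
      using that \<open>0 \<le> r\<close> by (intro mult_right_mono) auto
    finally show ?thesis .
  qed
  show ?thesis
    using **[of x y] **[of y x] assms by (cases "x \<le> y") (auto simp: abs_minus_commute)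
qed

lemma Lip_norm_ge:
  assumes "f \<in> Lip_on S" "x \<in> S" "y \<in> S" "x \<noteq> y"
  shows "\<bar>f x - f y\<bar> / \<bar>real x - real y\<bar> \<le> Lip_norm S f"
proof -
  have "(case (x, y) of (x, y) \<Rightarrow> \<bar>f x - f y\<bar> / \<bar>real x - real y\<bar>) \<le> Lip_norm S f"
    unfolding Lip_norm_def using assms by (intro cSUP_upper) (auto simp: Lip_on_def)
  then show ?thesis
    by simp
qed

lemma lip_steps_Lip_norm:
  assumes "f \<in> Lip_on {0..n}"
  shows "lip_steps n f (Lip_norm {0..n} f)"
proof (rule lip_stepsI)
  fix x assume "x < n"
  then show "\<bar>f (Suc x) - f x\<bar> \<le> Lip_norm {0..n} f"
    using Lip_norm_ge[OF assms, of "Suc x" x] by simp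
qed

subsection \<open>The transition semigroup\<close>

context finite_markov_chain
begin

definition trans :: "real \<Rightarrow> 's \<Rightarrow> 's \<Rightarrow> real" where
  "trans t x z = \<P>(\<omega> in P x. X t \<omega> = z)"

text \<open>A finite sum rather than an integral, so that composition and stationarity reduce to
  exchanging finite sums.\<close>

definition semigroup :: "real \<Rightarrow> ('s \<Rightarrow> real) \<Rightarrow> 's \<Rightarrow> real" where
  "semigroup t g x = (\<Sum>z\<in>S. trans t x z * g z)"

lemma trans_nonneg: "0 \<le> trans t x z"
  by (simp add: trans_def)

lemma space_P: "x \<in> S \<Longrightarrow> space (P x) = space M"
  using sets_P sets_eq_imp_space_eq by blast

lemma X_in_S: "\<lbrakk>0 \<le> t; \<omega> \<in> space M\<rbrakk> \<Longrightarrow> X t \<omega> \<in> S"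
  using measurable_space[OF measurable_X] by fastforce

lemma vimage_X_sets:
  assumes "0 \<le> t"
  shows "X t -` B \<inter> space M \<in> sets M"
proof -
  have "X t -` B \<inter> space M = X t -` (B \<inter> S) \<inter> space M"
    using X_in_S[OF assms] by auto
  also have "\<dots> \<in> sets M"
    by (rule measurable_sets[OF measurable_X[OF assms]]) simp
  finally show ?thesis .
qed

lemma Collect_X_sets:
  assumes "x \<in> S" "0 \<le> t"
  shows "{\<omega> \<in> space M. Q (X t \<omega>)} \<in> sets (P x)"
proof -
  have "{\<omega> \<in> space M. Q (X t \<omega>)} = X t -` Collect Q \<inter> space M"
    by auto
  then show ?thesis
    using vimage_X_sets[OF assms(2), of "Collect Q"] sets_P[OF assms(1)] by metis
qed

text \<open>Since \<open>X t\<close> takes values in the finite set \<open>S\<close>, the integrand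
  is a finite combination of indicators of the events \<open>X t = z\<close>.\<close>

lemma expectation_eq_semigroup:
  assumes x: "x \<in> S" and t: "0 \<le> t"
  shows "(\<integral>\<omega>. g (X t \<omega>) \<partial>P x) = semigroup t g x"
proof -
  interpret prob_space "P x"
    by (rule prob_space_P[OF x])
  let ?A = "\<lambda>z. {\<omega> \<in> space M. X t \<omega> = z}"
  have A: "?A z \<in> sets (P x)" for z
    by (rule Collect_X_sets[OF x t])
  have "(\<integral>\<omega>. g (X t \<omega>) \<partial>P x) = (\<integral>\<omega>. (\<Sum>z\<in>S. indicator (?A z) \<omega> * g z) \<partial>P x)"
  proof (rule Bochner_Integration.integral_cong[OF refl])
    fix \<omega> assume "\<omega> \<in> space (P x)"
    then have \<omega>: "\<omega> \<in> space M"
      using space_P[OF x] by simp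
    have "(\<Sum>z\<in>S. indicator (?A z) \<omega> * g z) = (\<Sum>z\<in>S. if z = X t \<omega> then g z else 0)"
      using \<omega> by (intro sum.cong) (auto simp: indicator_def)
    then show "g (X t \<omega>) = (\<Sum>z\<in>S. indicator (?A z) \<omega> * g z)"
      using X_in_S[OF t \<omega>] finite_states by simp
  qed
  also have "\<dots> = (\<Sum>z\<in>S. (\<integral>\<omega>. indicator (?A z) \<omega> * g z \<partial>P x))"
    using A by (intro Bochner_Integration.integral_sum) (auto simp: emeasure_eq_measure)
  also have "\<dots> = semigroup t g x"
    using A by (simp add: semigroup_def trans_def space_P[OF x] Int_absorb2 Collect_restrict)
  finally show ?thesis .
qed

lemma prob_eq_sum_trans:
  assumes x: "x \<in> S" and t: "0 \<le> t"
  shows "\<P>(\<omega> in P x. Q (X t \<omega>)) = sum (trans t x) {z \<in> S. Q z}"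
proof -
  interpret prob_space "P x"
    by (rule prob_space_P[OF x])
  have "\<P>(\<omega> in P x. Q (X t \<omega>)) = (\<integral>\<omega>. indicator (Collect Q) (X t \<omega>) \<partial>P x)"
  proof -
    have "(\<integral>\<omega>. indicator (Collect Q) (X t \<omega>) \<partial>P x)
        = (\<integral>\<omega>. indicator {\<omega> \<in> space M. Q (X t \<omega>)} \<omega> \<partial>P x :: real)"
      by (rule Bochner_Integration.integral_cong) (auto simp: indicator_def space_P[OF x])
    then show ?thesis
      using Collect_X_sets[OF x t, of Q] by (simp add: space_P[OF x] Int_absorb2 Collect_restrict)
  qed
  also have "\<dots> = (\<Sum>z\<in>S. trans t x z * indicator (Collect Q) z)"
    unfolding expectation_eq_semigroup[OF x t] semigroup_def ..
  also have "\<dots> = sum (trans t x) {z \<in> S. Q z}"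
    using finite_states by (simp add: indicator_def sum.If_cases Int_def)
  finally show ?thesis .
qed

lemma sum_trans: "\<lbrakk>x \<in> S; 0 \<le> t\<rbrakk> \<Longrightarrow> (\<Sum>z\<in>S. trans t x z) = 1"
  using prob_eq_sum_trans[of x t "\<lambda>_. True"] prob_space.prob_space[OF prob_space_P, of x] by simp

text \<open>Required for the conditional expectation in the Markov property to preserve
  integrals.\<close>

lemma subalgebra_natural_filtration:
  assumes "x \<in> S"
  shows "subalgebra (P x) (natural_filtration M X s)"
proof -
  have "{X u -` B \<inter> space M | u B. 0 \<le> u \<and> u \<le> s} \<subseteq> sets M"
    using vimage_X_sets by auto
  then have "sets (natural_filtration M X s) \<subseteq> sets M"
    unfolding natural_filtration_def
    by (subst sets_measure_of) (use sets.space_closed in \<open>blast intro: sets.sigma_sets_subset[THEN subsetD]\<close>)+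
  then show ?thesis
    using sets_P[OF assms] space_P[OF assms]
    by (auto simp: subalgebra_def natural_filtration_def space_measure_of_conv)
qed

text \<open>Integrate the Markov property: the conditional expectation has the integral of the
  indicator, and the other side is a function of \<open>X s\<close> alone.\<close>

lemma chapman_kolmogorov:
  assumes x: "x \<in> S" and z: "z \<in> S" and s: "0 \<le> s" and t: "0 \<le> t"
  shows "trans (s + t) x z = (\<Sum>w\<in>S. trans s x w * trans t w z)"
proof -
  interpret prob_space "P x"
    by (rule prob_space_P[OF x])
  let ?F = "natural_filtration M X s"
  let ?A = "{\<omega> \<in> space M. X (s + t) \<omega> = z}"
  interpret finite_measure_subalgebra "P x" ?F
    by standard (rule subalgebra_natural_filtration[OF x])
  have A: "?A \<in> sets (P x)"
    using s t by (intro Collect_X_sets[OF x]) simp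
  have int: "integrable (P x) (indicator ?A :: _ \<Rightarrow> real)"
    using A by (simp add: emeasure_eq_measure)
  have "trans (s + t) x z = (\<integral>\<omega>. indicator ?A \<omega> \<partial>P x)"
    using A by (simp add: trans_def space_P[OF x] Int_absorb2 Collect_restrict)
  also have "\<dots> = (\<integral>\<omega>. real_cond_exp (P x) ?F (indicator ?A) \<omega> \<partial>P x)"
    using real_cond_exp_int(2)[OF int] by simp
  also have "\<dots> = (\<integral>\<omega>. trans t (X s \<omega>) z \<partial>P x)"
  proof (rule integral_cong_AE)
    show "AE \<omega> in P x. real_cond_exp (P x) ?F (indicator ?A) \<omega> = trans t (X s \<omega>) z"
      using markov[OF x z s t] by (simp add: trans_def)
    have "X s \<in> measurable (P x) (count_space S)"
      using measurable_X[OF s] measurable_cong_sets[OF sets_P[OF x] refl] by blast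
    then show "(\<lambda>\<omega>. trans t (X s \<omega>) z) \<in> borel_measurable (P x)"
      by (rule measurable_compose) simp
  qed simp
  also have "\<dots> = (\<Sum>w\<in>S. trans s x w * trans t w z)"
    using expectation_eq_semigroup[OF x s, of "\<lambda>w. trans t w z"] by (simp add: semigroup_def)
  finally show ?thesis .
qed

lemma semigroup_add:
  assumes "x \<in> S" "0 \<le> s" "0 \<le> t"
  shows "semigroup (s + t) g x = semigroup s (semigroup t g) x"
proof -
  have "semigroup (s + t) g x = (\<Sum>z\<in>S. \<Sum>w\<in>S. trans s x w * trans t w z * g z)"
    using assms by (simp add: semigroup_def chapman_kolmogorov sum_distrib_right)
  also have "\<dots> = (\<Sum>w\<in>S. \<Sum>z\<in>S. trans s x w * trans t w z * g z)"
    by (rule sum.swap)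
  also have "\<dots> = semigroup s (semigroup t g) x"
    by (simp add: semigroup_def sum_distrib_left mult.assoc)
  finally show ?thesis .
qed

lemma semigroup_mono:
  "(\<And>z. z \<in> S \<Longrightarrow> g z \<le> g' z) \<Longrightarrow> semigroup t g x \<le> semigroup t g' x"
  unfolding semigroup_def by (intro sum_mono mult_left_mono trans_nonneg)

lemma semigroup_cmult: "semigroup t (\<lambda>z. c * g z) x = c * semigroup t g x"
  by (simp add: semigroup_def sum_distrib_left mult_ac)

lemma semigroup_diff_const:
  "\<lbrakk>x \<in> S; 0 \<le> t\<rbrakk> \<Longrightarrow> semigroup t (\<lambda>z. g z - c) x = semigroup t g x - c"
  by (simp add: semigroup_def right_diff_distrib sum_subtractf sum_trans flip: sum_distrib_right)

lemma stationary_sum_semigroup: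
  assumes "stationary_distribution S P X \<pi>" "0 \<le> t"
  shows "(\<Sum>x\<in>S. pmf \<pi> x * semigroup t g x) = (\<Sum>z\<in>S. pmf \<pi> z * g z)"
proof -
  have "(\<Sum>x\<in>S. pmf \<pi> x * semigroup t g x)
      = (\<Sum>x\<in>S. \<Sum>z\<in>S. pmf \<pi> x * trans t x z * g z)"
    by (simp add: semigroup_def sum_distrib_left mult.assoc)
  also have "\<dots> = (\<Sum>z\<in>S. (\<Sum>x\<in>S. pmf \<pi> x * trans t x z) * g z)"
    by (subst sum.swap) (simp add: sum_distrib_right)
  also have "\<dots> = (\<Sum>z\<in>S. pmf \<pi> z * g z)"
    using assms by (simp add: stationary_distribution_def trans_def)
  finally show ?thesis .
qed

end

section \<open>Small-time expansion of the birth-death semigroup\<close>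

lemma bd_generator_diff_const:
  "bd_generator b d (\<lambda>y. g y - c) x = bd_generator b d g x"
  by (simp add: bd_generator_def)

context birth_death_process
begin

lemma birth_nonneg: "x \<le> n \<Longrightarrow> 0 \<le> birth x"
  using birth_pos[of x] birth_top by (cases "x = n") auto

lemma death_nonneg: "x \<le> n \<Longrightarrow> 0 \<le> death x"
  using death_pos[of x] death_bot by (cases "x = 0") auto

lemma bd_generator_eq_sum:
  assumes "x \<le> n"
  shows "bd_generator birth death g x
    = (\<Sum>y\<in>{0..n}. bd_generator birth death (indicator {y}) x * g y)"
proof -
  have ind: "(\<Sum>y\<in>{0..n}. indicator {y} w * g y) = (if w \<le> n then g w else 0)" for w
    by (simp add: indicator_def of_bool_def if_distrib[of "\<lambda>a. a * _"] cong: if_cong)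
  have "(\<Sum>y\<in>{0..n}. bd_generator birth death (indicator {y}) x * g y)
      = birth x * ((\<Sum>y\<in>{0..n}. indicator {y} (x + 1) * g y) - (\<Sum>y\<in>{0..n}. indicator {y} x * g y))
      + death x * ((\<Sum>y\<in>{0..n}. indicator {y} (x - 1) * g y) - (\<Sum>y\<in>{0..n}. indicator {y} x * g y))"
    unfolding bd_generator_def
    by (simp only: distrib_right sum.distrib left_diff_distrib mult.assoc right_diff_distrib
      sum_subtractf flip: sum_distrib_left)
  \<comment> \<open>For \<open>x = n\<close> the sum drops the value at \<open>n + 1\<close>, which
    the generator multiplies by \<open>birth n = 0\<close>.\<close>
  also have "\<dots> = bd_generator birth death g x"
    unfolding ind using assms birth_top
    by (cases "x = n") (auto simp: bd_generator_def)
  finally show ?thesis ..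
qed

text \<open>The threshold for \<open>h\<close> does not depend on \<open>g\<close>: the generator
  limit is taken only for the finitely many indicators, and a general \<open>g\<close> follows by
  linearity. This uniformity matters because the small-time estimates below must hold for all
  functions at once to be composed. Constants cancel, so the error involves only differences of
  \<open>g\<close>.\<close>

lemma semigroup_approx:
  assumes "0 < \<epsilon>"
  shows "\<forall>\<^sub>F h in at_right 0. \<forall>x\<in>{0..n}. \<forall>g.
    \<bar>semigroup h g x - g x - h * bd_generator birth death g x\<bar>
      \<le> \<epsilon> * h * (\<Sum>y\<in>{0..n}. \<bar>g y - g x\<bar>)"
proof -
  let ?L = "bd_generator birth death"
  have "\<forall>\<^sub>F h in at_right 0. \<forall>x\<in>{0..n}. \<forall>y\<in>{0..n}.
      \<bar>((\<integral>\<omega>. indicator {y} (X h \<omega>) \<partial>P x) - indicator {y} x) / h - ?L (indicator {y}) x\<bar> < \<epsilon>"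
  proof (intro eventually_ball_finite ballI)
    fix x y assume "x \<in> {0..n}"
    then have "((\<lambda>h. ((\<integral>\<omega>. indicator {y} (X h \<omega>) \<partial>P x) - indicator {y} x) / h)
        \<longlongrightarrow> ?L (indicator {y}) x) (at_right 0)"
      using generator unfolding has_generator_def by blast
    from tendstoD[OF this assms]
    show "\<forall>\<^sub>F h in at_right 0.
        \<bar>((\<integral>\<omega>. indicator {y} (X h \<omega>) \<partial>P x) - indicator {y} x) / h - ?L (indicator {y}) x\<bar> < \<epsilon>"
      by (simp add: dist_real_def)
  qed simp_all
  then show ?thesis
    using eventually_at_right_less[of "0::real"]
  proof eventually_elim
    case (elim h)
    show ?case
    proof (intro ballI allI)
      fix x and g :: "nat \<Rightarrow> real"
      assume x: "x \<in> {0..n}"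
      define e where "e y = trans h x y - indicator {y} x - h * ?L (indicator {y}) x" for y
      have e: "\<bar>e y\<bar> \<le> \<epsilon> * h" if y: "y \<in> {0..n}" for y
      proof -
        have "(\<integral>\<omega>. indicator {y} (X h \<omega>) \<partial>P x) = trans h x y"
          using expectation_eq_semigroup[OF x, of h "indicator {y}"] elim y
          by (simp add: semigroup_def indicator_def of_bool_def if_distrib[of "\<lambda>a. _ * a"] cong: if_cong)
        then have "\<bar>(trans h x y - indicator {y} x) / h - ?L (indicator {y}) x\<bar> < \<epsilon>"
          using elim x y by metis
        then have "\<bar>((trans h x y - indicator {y} x) / h - ?L (indicator {y}) x) * h\<bar> \<le> \<epsilon> * h"
          unfolding abs_mult using elim by (intro mult_mono) auto
        moreover have "((trans h x y - indicator {y} x) / h - ?L (indicator {y}) x) * h = e y"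
          using elim by (simp add: e_def left_diff_distrib[of "_ / h"])
        ultimately show ?thesis
          by simp
      qed
      \<comment> \<open>Centring at \<open>x\<close> makes the zeroth-order term vanish and leaves
        an error in terms of differences.\<close>
      define k where "k y = g y - g x" for y
      have "(\<Sum>y\<in>{0..n}. e y * k y) = semigroup h k x
          - (\<Sum>y\<in>{0..n}. indicator {y} x * k y) - h * ?L k x"
        using x by (simp add: e_def semigroup_def bd_generator_eq_sum[of x k] left_diff_distrib
          sum_subtractf sum_distrib_left mult.assoc)
      also have "(\<Sum>y\<in>{0..n}. indicator {y} x * k y) = 0"
        by (rule sum.neutral) (auto simp: indicator_def k_def)
      also have "semigroup h k x = semigroup h g x - g x"
        unfolding k_def using x elim by (intro semigroup_diff_const) auto
      also have "?L k x = ?L g x"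
        unfolding k_def by (rule bd_generator_diff_const)
      finally have "\<bar>semigroup h g x - g x - h * ?L g x\<bar> = \<bar>\<Sum>y\<in>{0..n}. e y * k y\<bar>"
        by simp
      also have "\<dots> \<le> (\<Sum>y\<in>{0..n}. \<bar>e y\<bar> * \<bar>k y\<bar>)"
        by (rule order_trans[OF sum_abs]) (simp add: abs_mult)
      also have "\<dots> \<le> (\<Sum>y\<in>{0..n}. (\<epsilon> * h) * \<bar>k y\<bar>)"
        using e by (intro sum_mono mult_right_mono) auto
      finally show "\<bar>semigroup h g x - g x - h * ?L g x\<bar> \<le> \<epsilon> * h * (\<Sum>y\<in>{0..n}. \<bar>g y - g x\<bar>)"
        by (simp add: k_def sum_distrib_left)
    qed
  qed
qed

end

subsection \<open>Positive Wasserstein curvature\<close>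

text \<open>These are the two consequences of the rate condition that drive the proof. In the
  generator difference at \<open>Suc x\<close> and \<open>x\<close>, the increment of
  \<open>g\<close> there decays at rate \<open>birth x + death (Suc x)\<close>, and the adjacent
  increments enter at rates \<open>birth (Suc x)\<close> and \<open>death x\<close>;
  \<open>curvature\<close> says that the decay wins by \<open>\<rho>\<close>. \<open>V\<close>
  bounds the total jump rate.\<close>

locale curved_birth_death = birth_death_process n birth death M P X
  for n :: nat
    and birth death :: "nat \<Rightarrow> real"
    and M :: "'a measure"
    and P :: "nat \<Rightarrow> 'a measure"
    and X :: "real \<Rightarrow> 'a \<Rightarrow> nat" +
  fixes \<rho> V :: real
  assumes n_pos: "0 < n"
    and curvature_pos: "0 < \<rho>"
    and curvature: "x < n \<Longrightarrow> birth (Suc x) + death x + \<rho> \<le> birth x + death (Suc x)"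
    and rate_le: "x \<le> n \<Longrightarrow> birth x + death x \<le> V"
begin

lemma V_pos: "0 < V"
  using rate_le[of 0] birth_pos[of 0] death_bot n_pos by simp

lemma lip_steps_nonneg: "lip_steps n g r \<Longrightarrow> 0 \<le> r"
  using lip_stepsD[of n g r 0] n_pos by linarith

lemma sum_abs_le:
  assumes "lip_steps n g r" "x \<le> n"
  shows "(\<Sum>y\<in>{0..n}. \<bar>g y - g x\<bar>) \<le> real (Suc n) * (real n * r)"
proof -
  have "(\<Sum>y\<in>{0..n}. \<bar>g y - g x\<bar>) \<le> (\<Sum>y\<in>{0..n}. real n * r)"
    using assms by (intro sum_mono lip_steps_dist lip_steps_nonneg) auto
  then show ?thesis
    by simp
qed

section \<open>Contraction of the Lipschitz seminorm\<close>

text \<open>The new increment is a combination of three adjacent old ones. The coefficients are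
  nonnegative for small \<open>h\<close>, and by \<open>curvature\<close> their sum is at most
  \<open>1 - \<rho> * h\<close>.\<close>

lemma euler_step_contraction:
  assumes g: "lip_steps n g r" and x: "x < n"
    and h: "0 \<le> h" "h * (birth x + death (Suc x)) \<le> 1"
  shows "\<bar>(g (Suc x) + h * bd_generator birth death g (Suc x))
      - (g x + h * bd_generator birth death g x)\<bar> \<le> (1 - \<rho> * h) * r"
proof -
  define a where "a = birth (Suc x)"
  define b where "b = death x"
  define c where "c = 1 - h * (birth x + death (Suc x))"
  define D where "D = g (Suc x) - g x"
  define D1 where "D1 = g (Suc (Suc x)) - g (Suc x)"
  define D0 where "D0 = g x - g (x - 1)"
  have r: "0 \<le> r"
    by (rule lip_steps_nonneg[OF g])
  have "\<bar>D\<bar> \<le> r"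
    using lip_stepsD[OF g x] by (simp add: D_def)
  \<comment> \<open>\<open>D1\<close> reaches beyond \<open>n\<close> when \<open>Suc x = n\<close>,
    but then \<open>a = birth n = 0\<close>; below, \<open>b = death 0 = 0\<close> covers
    \<open>x = 0\<close>.\<close>
  moreover have "a * \<bar>D1\<bar> \<le> a * r"
    using lip_stepsD[OF g, of "Suc x"] birth_nonneg[of "Suc x"] x birth_top
    by (cases "Suc x = n") (auto simp: a_def D1_def intro!: mult_left_mono)
  moreover have "b * \<bar>D0\<bar> \<le> b * r"
    using lip_stepsD[OF g, of "x - 1"] death_nonneg[of x] x death_bot
    by (cases "x = 0") (auto simp: b_def D0_def intro!: mult_left_mono)
  moreover have "0 \<le> a" "0 \<le> b" "0 \<le> c"
    using x h birth_nonneg death_nonneg by (auto simp: a_def b_def c_def)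
  ultimately have "c * \<bar>D\<bar> + h * (a * \<bar>D1\<bar>) + h * (b * \<bar>D0\<bar>) \<le> c * r + h * (a * r) + h * (b * r)"
    and "\<bar>c * D\<bar> = c * \<bar>D\<bar>" "\<bar>h * (a * D1)\<bar> = h * (a * \<bar>D1\<bar>)" "\<bar>h * (b * D0)\<bar> = h * (b * \<bar>D0\<bar>)"
    using h by (auto simp: abs_mult intro!: add_mono mult_left_mono)
  moreover have "(c + h * a + h * b) * r \<le> (1 - \<rho> * h) * r"
    using mult_left_mono[OF curvature[OF x] h(1)] r
    by (intro mult_right_mono) (auto simp: a_def b_def c_def algebra_simps)
  moreover have "(g (Suc x) + h * bd_generator birth death g (Suc x))
      - (g x + h * bd_generator birth death g x) = c * D + h * (a * D1) + h * (b * D0)"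
    by (simp add: bd_generator_def a_def b_def c_def D_def D1_def D0_def algebra_simps)
  moreover have "(c + h * a + h * b) * r = c * r + h * (a * r) + h * (b * r)"
    by (simp add: algebra_simps)
  ultimately show ?thesis
    by linarith
qed

text \<open>The Euler step contracts, and the expansion error is proportional to
  \<open>h * r\<close>, so a loss of \<open>\<epsilon>\<close> in the rate absorbs it uniformly in
  \<open>g\<close> and \<open>r\<close>.\<close>

lemma eventually_lip_contraction:
  assumes "0 < \<epsilon>"
  shows "\<forall>\<^sub>F h in at_right 0. \<forall>g r. lip_steps n g r \<longrightarrow>
    lip_steps n (semigroup h g) (exp (- (\<rho> - \<epsilon>) * h) * r)"
proof -
  \<comment> \<open>Chosen so that the errors at the two neighbouring points add up to
    \<open>\<epsilon> * h * r\<close>.\<close>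
  define \<delta> where "\<delta> = \<epsilon> / (2 * (real (Suc n) * real n))"
  have \<delta>: "0 < \<delta>" "2 * (\<delta> * (real (Suc n) * real n)) = \<epsilon>"
    using assms n_pos by (simp_all add: \<delta>_def)
  have "\<forall>\<^sub>F h in at_right 0. \<forall>x\<in>{..<n}. h * (birth x + death (Suc x)) < 1"
  proof (intro eventually_ball_finite ballI)
    fix x
    have "((\<lambda>h. h * (birth x + death (Suc x))) \<longlongrightarrow> 0 * (birth x + death (Suc x))) (at_right 0)"
      by (intro tendsto_intros)
    then show "\<forall>\<^sub>F h in at_right 0. h * (birth x + death (Suc x)) < 1"
      by (intro order_tendstoD(2)) auto
  qed simp
  then show ?thesis
    using eventually_at_right_less[of "0::real"] semigroup_approx[OF \<delta>(1)]
  proof eventually_elim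
    case (elim h)
    show ?case
    proof (intro allI impI lip_stepsI)
      fix g r x assume g: "lip_steps n g r" and x: "x < n"
      let ?E = "\<lambda>x. g x + h * bd_generator birth death g x"
      have err: "\<bar>semigroup h g z - ?E z\<bar> \<le> \<delta> * h * (real (Suc n) * (real n * r))" if "z \<le> n" for z
      proof -
        have "\<bar>semigroup h g z - ?E z\<bar> \<le> \<delta> * h * (\<Sum>y\<in>{0..n}. \<bar>g y - g z\<bar>)"
          using elim that by (simp add: diff_diff_add)
        also have "\<dots> \<le> \<delta> * h * (real (Suc n) * (real n * r))"
          using elim that \<delta> g by (intro mult_left_mono sum_abs_le) auto
        finally show ?thesis .
      qed
      have "\<bar>semigroup h g (Suc x) - semigroup h g x\<bar>
          \<le> \<bar>?E (Suc x) - ?E x\<bar> + 2 * (\<delta> * h * (real (Suc n) * (real n * r)))"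
        using err[of x] err[of "Suc x"] x by linarith
      also have "\<dots> \<le> (1 - \<rho> * h) * r + 2 * (\<delta> * h * (real (Suc n) * (real n * r)))"
        using euler_step_contraction[OF g x, of h] elim x
        by (intro add_right_mono) (auto simp: less_imp_le)
      also have "\<dots> = (1 - \<rho> * h) * r + 2 * (\<delta> * (real (Suc n) * real n)) * h * r"
        by (simp only: mult_ac)
      also have "\<dots> = (1 + (- (\<rho> - \<epsilon>) * h)) * r"
        unfolding \<delta>(2) by (simp add: algebra_simps)
      also have "\<dots> \<le> exp (- (\<rho> - \<epsilon>) * h) * r"
        by (intro mult_right_mono exp_ge_add_one_self lip_steps_nonneg[OF g])
      finally show "\<bar>semigroup h g (Suc x) - semigroup h g x\<bar> \<le> exp (- (\<rho> - \<epsilon>) * h) * r" .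
    qed
  qed
qed

lemma lip_steps_cong:
  "(\<And>x. x \<le> n \<Longrightarrow> g x = g' x) \<Longrightarrow> lip_steps n g r \<longleftrightarrow> lip_steps n g' r"
  by (simp add: lip_steps_def)

text \<open>For fixed \<open>\<epsilon>\<close> the contraction factors multiply under composition,
  so the small-time estimate extends to \<open>t\<close>; then \<open>\<epsilon>\<close> tends to
  0.\<close>

lemma lip_contraction:
  assumes g: "lip_steps n g r" and "0 < t"
  shows "lip_steps n (semigroup t g) (exp (- \<rho> * t) * r)"
proof -
  have approx: "\<forall>g r. lip_steps n g r \<longrightarrow> lip_steps n (semigroup t g) (exp (- (\<rho> - \<epsilon>) * t) * r)"
    if "0 < \<epsilon>" for \<epsilon>
  proof (rule additive_property_at_right_imp_all[OF eventually_lip_contraction[OF that] _ \<open>0 < t\<close>],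
      intro allI impI)
    fix s t g r
    assume st: "(0::real) < s" "(0::real) < t" and g: "lip_steps n g r"
      and "\<forall>g r. lip_steps n g r \<longrightarrow> lip_steps n (semigroup s g) (exp (- (\<rho> - \<epsilon>) * s) * r)"
      and "\<forall>g r. lip_steps n g r \<longrightarrow> lip_steps n (semigroup t g) (exp (- (\<rho> - \<epsilon>) * t) * r)"
    then have "lip_steps n (semigroup s (semigroup t g))
        (exp (- (\<rho> - \<epsilon>) * s) * (exp (- (\<rho> - \<epsilon>) * t) * r))"
      by blast
    also have "exp (- (\<rho> - \<epsilon>) * s) * (exp (- (\<rho> - \<epsilon>) * t) * r) = exp (- (\<rho> - \<epsilon>) * (s + t)) * r"
      by (simp add: distrib_left exp_add)
    finally show "lip_steps n (semigroup (s + t) g) (exp (- (\<rho> - \<epsilon>) * (s + t)) * r)"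
      using st by (subst lip_steps_cong[where g' = "semigroup s (semigroup t g)"])
        (auto intro: semigroup_add)
  qed
  show ?thesis
  proof (rule lip_stepsI)
    fix x assume "x < n"
    have "((\<lambda>\<epsilon>. exp (- (\<rho> - \<epsilon>) * t) * r) \<longlongrightarrow> exp (- (\<rho> - 0) * t) * r) (at_right 0)"
      by (intro tendsto_intros)
    moreover have "\<forall>\<^sub>F \<epsilon> in at_right 0.
        \<bar>semigroup t g (Suc x) - semigroup t g x\<bar> \<le> exp (- (\<rho> - \<epsilon>) * t) * r"
      using eventually_at_right_less[of "0::real"]
      by eventually_elim (use approx g \<open>x < n\<close> in \<open>auto dest: lip_stepsD\<close>)
    ultimately show "\<bar>semigroup t g (Suc x) - semigroup t g x\<bar> \<le> exp (- \<rho> * t) * r"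
      using tendsto_lowerbound by fastforce
  qed
qed

section \<open>Bounds on the Laplace transform\<close>

text \<open>The integral of \<open>V * exp (- 2 * \<rho> * s)\<close> over \<open>s\<close> from 0
  to \<open>t\<close>.\<close>

definition variance_factor :: "real \<Rightarrow> real" where
  "variance_factor t = V * (1 - exp (- 2 * \<rho> * t)) / (2 * \<rho>)"

lemma variance_factor_nonneg: "0 \<le> t \<Longrightarrow> 0 \<le> variance_factor t"
  using curvature_pos V_pos by (simp add: variance_factor_def)

lemma variance_factor_pos: "0 < t \<Longrightarrow> 0 < variance_factor t"
  using curvature_pos V_pos by (simp add: variance_factor_def)

text \<open>Split the integral at \<open>s\<close> and shift. The square matches
  \<open>exp_excess_scale\<close> at the contraction factor of time \<open>s\<close>, so composing
  two Laplace bounds loses nothing.\<close>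

lemma variance_factor_add:
  "variance_factor (s + t) = variance_factor s + (exp (- \<rho> * s))\<^sup>2 * variance_factor t"
proof -
  have "(exp (- \<rho> * s))\<^sup>2 = exp (- 2 * \<rho> * s)"
    by (simp flip: exp_double)
  moreover have "exp (- 2 * \<rho> * (s + t)) = exp (- 2 * \<rho> * s) * exp (- 2 * \<rho> * t)"
    by (simp add: algebra_simps flip: exp_add)
  ultimately show ?thesis
    unfolding variance_factor_def using curvature_pos by (simp add: divide_simps) (simp add: algebra_simps)
qed

text \<open>The slope at 0 is \<open>V\<close>, so the generator estimate \<open>V * h\<close> may
  be replaced by \<open>variance_factor h\<close> up to second order.\<close>

lemma variance_factor_ge:
  assumes "0 \<le> h"
  shows "V * h - 2 * \<rho> * V * h\<^sup>2 \<le> variance_factor h"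
proof -
  have "V * (2 * \<rho> * h - (2 * \<rho> * h)\<^sup>2) / (2 * \<rho>) \<le> variance_factor h"
    unfolding variance_factor_def
    using one_minus_exp_ge[of "2 * \<rho> * h"] curvature_pos V_pos assms
    by (intro divide_right_mono mult_left_mono) auto
  moreover have "V * (2 * \<rho> * h - (2 * \<rho> * h)\<^sup>2) / (2 * \<rho>) = V * h - 2 * \<rho> * V * h\<^sup>2"
    using curvature_pos by (simp add: divide_simps) (simp add: algebra_simps power2_eq_square)
  ultimately show ?thesis
    by simp
qed

text \<open>Subtracting the generator of \<open>g\<close> removes the linear part of each
  exponential increment; what remains is \<open>exp_excess\<close> of the jumps, weighted by rates
  of total at most \<open>V\<close>.\<close>

lemma bd_generator_exp_le:
  assumes g: "lip_steps n g r" and x: "x \<le> n"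
  shows "bd_generator birth death (\<lambda>y. exp (g y - g x)) x - bd_generator birth death g x
    \<le> V * exp_excess r"
proof -
  have "bd_generator birth death (\<lambda>y. exp (g y - g x)) x - bd_generator birth death g x
      = birth x * exp_excess (g (Suc x) - g x) + death x * exp_excess (g (x - 1) - g x)"
    by (simp add: bd_generator_def exp_excess_def algebra_simps)
  also have "\<dots> \<le> birth x * exp_excess r + death x * exp_excess r"
  proof (rule add_mono)
    show "birth x * exp_excess (g (Suc x) - g x) \<le> birth x * exp_excess r"
      using lip_stepsD[OF g, of x] birth_nonneg[OF x] x birth_top
      by (cases "x = n") (auto intro!: mult_left_mono exp_excess_abs_le)
    show "death x * exp_excess (g (x - 1) - g x) \<le> death x * exp_excess r"
      using lip_stepsD[OF g, of "x - 1"] death_nonneg[OF x] x death_bot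
      by (cases "x = 0") (auto intro!: mult_left_mono exp_excess_abs_le simp: abs_minus_commute)
  qed
  also have "\<dots> \<le> V * exp_excess r"
    using mult_right_mono[OF rate_le[OF x] exp_excess_nonneg[of r]] by (simp add: distrib_right)
  finally show ?thesis .
qed

text \<open>Expand the semigroup on \<open>exp (g - g x)\<close> and on \<open>g\<close> to first
  order, compare the generators, and use \<open>1 + a \<le> exp a\<close>. The bound
  \<open>R\<close> keeps the oscillation of the exponentials, hence the error, uniform in
  \<open>g\<close>.\<close>

lemma eventually_laplace:
  assumes "0 < \<epsilon>"
  shows "\<forall>\<^sub>F h in at_right 0. \<forall>g r. r \<le> R \<longrightarrow> lip_steps n g r \<longrightarrow> (\<forall>x\<in>{0..n}.
    semigroup h (\<lambda>z. exp (g z)) x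
      \<le> exp (semigroup h g x + variance_factor h * exp_excess r + \<epsilon> * h))"
proof -
  \<comment> \<open>\<open>K\<close> bounds the total oscillation of both \<open>g\<close> and its
    centred exponential. The two expansions cost \<open>\<epsilon> / 4 * h\<close> each, and
    \<open>\<epsilon> / 2 * h\<close> pays for the quadratic loss in
    \<open>variance_factor_ge\<close>.\<close>
  define K where "K = real (Suc n) * exp (real n * R)"
  define \<delta> where "\<delta> = \<epsilon> / (4 * K)"
  have K: "0 < K"
    by (simp add: K_def)
  have \<delta>: "0 < \<delta>" "\<delta> * K = \<epsilon> / 4"
    using K assms by (simp_all add: \<delta>_def)
  have "((\<lambda>h. h * (2 * \<rho> * V * exp_excess R)) \<longlongrightarrow> 0 * (2 * \<rho> * V * exp_excess R)) (at_right 0)"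
    by (intro tendsto_intros)
  then have "\<forall>\<^sub>F h in at_right 0. h * (2 * \<rho> * V * exp_excess R) < \<epsilon> / 2"
    using assms by (intro order_tendstoD(2)) auto
  then show ?thesis
    using eventually_at_right_less[of "0::real"] semigroup_approx[OF \<delta>(1)]
  proof eventually_elim
    case (elim h)
    show ?case
    proof (intro allI impI ballI)
      fix g r x assume rR: "r \<le> R" and g: "lip_steps n g r" and x: "x \<in> {0..n}"
      let ?L = "bd_generator birth death"
      \<comment> \<open>Dividing by \<open>exp (g x)\<close> bounds the function in terms of
        \<open>R\<close> alone, however large \<open>g\<close> is; the factor is restored at the
        end.\<close>
      define k where "k y = exp (g y - g x)" for y
      have r: "0 \<le> r"
        by (rule lip_steps_nonneg[OF g])
      have dist: "\<bar>g y - g x\<bar> \<le> real n * R" if "y \<in> {0..n}" for y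
        using order_trans[OF lip_steps_dist[OF g r, of x y] mult_left_mono[OF rR]] that x by simp
      have "(\<Sum>y\<in>{0..n}. \<bar>g y - g x\<bar>) \<le> (\<Sum>y\<in>{0..n}. exp (real n * R))"
      proof (rule sum_mono)
        fix y assume "y \<in> {0..n}"
        then show "\<bar>g y - g x\<bar> \<le> exp (real n * R)"
          using dist[of y] exp_ge_add_one_self[of "real n * R"] by linarith
      qed
      then have "\<delta> * h * (\<Sum>y\<in>{0..n}. \<bar>g y - g x\<bar>) \<le> \<delta> * h * K"
        using elim \<delta> by (intro mult_left_mono) (auto simp: K_def)
      moreover have "(\<Sum>y\<in>{0..n}. \<bar>k y - k x\<bar>) \<le> (\<Sum>y\<in>{0..n}. exp (real n * R))"
      proof (rule sum_mono)
        fix y assume y: "y \<in> {0..n}"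
        have "k y \<le> exp (real n * R)" "0 < k y" "1 \<le> exp (real n * R)"
          using dist[OF y] by (auto simp: k_def)
        moreover have "k x = 1"
          by (simp add: k_def)
        ultimately show "\<bar>k y - k x\<bar> \<le> exp (real n * R)"
          by linarith
      qed
      then have "\<delta> * h * (\<Sum>y\<in>{0..n}. \<bar>k y - k x\<bar>) \<le> \<delta> * h * K"
        using elim \<delta> by (intro mult_left_mono) (auto simp: K_def)
      moreover have "\<bar>semigroup h g x - g x - h * ?L g x\<bar> \<le> \<delta> * h * (\<Sum>y\<in>{0..n}. \<bar>g y - g x\<bar>)"
        "\<bar>semigroup h k x - k x - h * ?L k x\<bar> \<le> \<delta> * h * (\<Sum>y\<in>{0..n}. \<bar>k y - k x\<bar>)"
        using elim x by blast+
      moreover have "\<delta> * h * K = \<epsilon> / 4 * h"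
        using \<delta>(2) by (simp add: mult_ac)
      ultimately have approx: "semigroup h k x \<le> 1 + h * ?L k x + \<epsilon> / 4 * h"
        "g x + h * ?L g x \<le> semigroup h g x + \<epsilon> / 4 * h"
        by (auto simp: k_def)
      have "h * (?L k x - ?L g x) \<le> h * (V * exp_excess r)"
        unfolding k_def using elim x by (intro mult_left_mono bd_generator_exp_le[OF g]) auto
      also have "\<dots> = (V * h - 2 * \<rho> * V * h\<^sup>2) * exp_excess r
          + h * (h * (2 * \<rho> * V * exp_excess r))"
        by (simp add: algebra_simps power2_eq_square)
      also have "\<dots> \<le> variance_factor h * exp_excess r + h * (\<epsilon> / 2)"
      proof (intro add_mono mult_right_mono mult_left_mono)
        have "h * (2 * \<rho> * V * exp_excess r) \<le> h * (2 * \<rho> * V * exp_excess R)"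
          using elim curvature_pos V_pos r rR by (intro mult_left_mono exp_excess_mono) auto
        with elim show "h * (2 * \<rho> * V * exp_excess r) \<le> \<epsilon> / 2"
          by linarith
      qed (use elim variance_factor_ge exp_excess_nonneg in auto)
      finally have *: "h * ?L k x \<le> h * ?L g x + variance_factor h * exp_excess r + h * (\<epsilon> / 2)"
        by (simp add: algebra_simps)
      have "semigroup h k x \<le> exp (h * ?L k x + \<epsilon> / 4 * h)"
        using approx(1) exp_ge_add_one_self[of "h * ?L k x + \<epsilon> / 4 * h"] by linarith
      then have "exp (g x) * semigroup h k x \<le> exp (g x + (h * ?L k x + \<epsilon> / 4 * h))"
        by (simp add: exp_add)
      also have "\<dots> \<le> exp (semigroup h g x + variance_factor h * exp_excess r + \<epsilon> * h)"
        using * approx(2) by (simp add: algebra_simps)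
      finally show "semigroup h (\<lambda>z. exp (g z)) x
          \<le> exp (semigroup h g x + variance_factor h * exp_excess r + \<epsilon> * h)"
        unfolding semigroup_cmult[symmetric] by (simp add: k_def flip: exp_add)
    qed
  qed
qed

text \<open>Composition applies the bound for time \<open>s\<close> to \<open>g\<close> and the
  bound for time \<open>t\<close> to \<open>semigroup s g\<close>, whose Lipschitz bound has shrunk;
  \<open>exp_excess_scale\<close> and \<open>variance_factor_add\<close> then recombine the
  exponents. Finally \<open>\<epsilon>\<close> tends to 0.\<close>

lemma laplace:
  assumes g: "lip_steps n g r" and "0 < t" and x: "x \<in> {0..n}"
  shows "semigroup t (\<lambda>z. exp (g z)) x \<le> exp (semigroup t g x + variance_factor t * exp_excess r)"
proof -
  have approx: "\<forall>g r'. r' \<le> r \<longrightarrow> lip_steps n g r' \<longrightarrow> (\<forall>x\<in>{0..n}. semigroup t (\<lambda>z. exp (g z)) x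
      \<le> exp (semigroup t g x + variance_factor t * exp_excess r' + \<epsilon> * t))"
    if "0 < \<epsilon>" for \<epsilon>
  proof (rule additive_property_at_right_imp_all[OF eventually_laplace[OF that] _ \<open>0 < t\<close>],
      intro allI impI ballI)
    fix s t g r' x
    assume st: "(0::real) < s" "(0::real) < t" and g: "lip_steps n g r'" and r': "r' \<le> r"
      and x: "x \<in> {0..n}"
      and IHs: "\<forall>g r'. r' \<le> r \<longrightarrow> lip_steps n g r' \<longrightarrow> (\<forall>x\<in>{0..n}. semigroup s (\<lambda>z. exp (g z)) x
        \<le> exp (semigroup s g x + variance_factor s * exp_excess r' + \<epsilon> * s))"
      and IHt: "\<forall>g r'. r' \<le> r \<longrightarrow> lip_steps n g r' \<longrightarrow> (\<forall>x\<in>{0..n}. semigroup t (\<lambda>z. exp (g z)) x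
        \<le> exp (semigroup t g x + variance_factor t * exp_excess r' + \<epsilon> * t))"
    define a where "a = exp (- \<rho> * s)"
    define c where "c = variance_factor s * exp_excess r' + \<epsilon> * s"
    have a: "0 \<le> a" "a \<le> 1"
      using st curvature_pos by (auto simp: a_def)
    have r0: "0 \<le> r'"
      by (rule lip_steps_nonneg[OF g])
    \<comment> \<open>The contracted function stays in the class for which the bound at time
      \<open>t\<close> is assumed.\<close>
    have "a * r' \<le> r"
      using mult_right_mono[OF a(2) r0] r' by simp
    have "semigroup (s + t) (\<lambda>z. exp (g z)) x = semigroup t (semigroup s (\<lambda>z. exp (g z))) x"
      using semigroup_add[of x t s] x st by (simp add: add.commute)
    also have "\<dots> \<le> semigroup t (\<lambda>z. exp c * exp (semigroup s g z)) x"
      using IHs r' g by (intro semigroup_mono) (auto simp: c_def add_ac simp flip: exp_add)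
    also have "\<dots> = exp c * semigroup t (\<lambda>z. exp (semigroup s g z)) x"
      by (rule semigroup_cmult)
    also have "\<dots> \<le> exp c * exp (semigroup t (semigroup s g) x
        + variance_factor t * exp_excess (a * r') + \<epsilon> * t)"
      using IHt lip_contraction[OF g st(1)] x \<open>a * r' \<le> r\<close> by (intro mult_left_mono) (auto simp: a_def)
    also have "\<dots> \<le> exp c * exp (semigroup t (semigroup s g) x
        + variance_factor t * (a\<^sup>2 * exp_excess r') + \<epsilon> * t)"
      using exp_excess_scale[OF a r0] variance_factor_nonneg[of t] st
      by (intro mult_left_mono iffD2[OF exp_le_cancel_iff] add_mono order_refl) auto
    also have "\<dots> = exp (semigroup (s + t) g x + variance_factor (s + t) * exp_excess r'
        + \<epsilon> * (s + t))"
      using semigroup_add[of x t s g] x st variance_factor_add[of s t]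
      by (simp add: c_def a_def add.commute algebra_simps flip: exp_add)
    finally show "semigroup (s + t) (\<lambda>z. exp (g z)) x
        \<le> exp (semigroup (s + t) g x + variance_factor (s + t) * exp_excess r' + \<epsilon> * (s + t))" .
  qed
  have "((\<lambda>\<epsilon>. exp (semigroup t g x + variance_factor t * exp_excess r + \<epsilon> * t))
      \<longlongrightarrow> exp (semigroup t g x + variance_factor t * exp_excess r + 0 * t)) (at_right 0)"
    by (intro tendsto_intros)
  moreover have "\<forall>\<^sub>F \<epsilon> in at_right 0. semigroup t (\<lambda>z. exp (g z)) x
      \<le> exp (semigroup t g x + variance_factor t * exp_excess r + \<epsilon> * t)"
    using eventually_at_right_less[of "0::real"]
    by eventually_elim (use approx g x in auto)
  ultimately show ?thesis
    using tendsto_lowerbound by fastforce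
qed

lemma lip_steps_cmult: "0 \<le> c \<Longrightarrow> lip_steps n g r \<Longrightarrow> lip_steps n (\<lambda>z. c * g z) (c * r)"
  by (auto simp: lip_steps_def abs_mult mult_left_mono simp flip: right_diff_distrib)

lemma laplace_centered:
  assumes g: "lip_steps n g r" and "0 < t" and x: "x \<in> {0..n}" and "0 < \<tau>"
  shows "(\<Sum>z\<in>{0..n}. trans t x z * exp (\<tau> * (g z - semigroup t g x)))
    \<le> exp (variance_factor t * exp_excess (\<tau> * r))"
proof -
  have "semigroup t (\<lambda>z. exp (\<tau> * g z)) x
      \<le> exp (\<tau> * semigroup t g x + variance_factor t * exp_excess (\<tau> * r))"
    using laplace[OF lip_steps_cmult[OF _ g, of \<tau>] assms(2) x] \<open>0 < \<tau>\<close>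
    by (simp add: semigroup_cmult)
  moreover have "(\<Sum>z\<in>{0..n}. trans t x z * exp (\<tau> * (g z - semigroup t g x)))
      = semigroup t (\<lambda>z. exp (\<tau> * g z)) x / exp (\<tau> * semigroup t g x)"
    by (simp add: semigroup_def right_diff_distrib exp_diff sum_divide_distrib)
  ultimately show ?thesis
    by (simp add: exp_add divide_le_eq mult.commute)
qed

section \<open>Passage to the stationary distribution\<close>

text \<open>Average the bound at time \<open>t\<close> over the starting point. By stationarity
  \<open>m\<close> is the mean of \<open>semigroup t g\<close>, whose oscillation is at most
  \<open>n * exp (- \<rho> * t) * r\<close>, so the centring error vanishes as \<open>t\<close>
  grows while the variance factor tends to \<open>V / (2 * \<rho>)\<close>.\<close>

lemma laplace_stationary:
  assumes st: "stationary_distribution {0..n} P X \<pi>" and g: "lip_steps n g r" and "0 < \<tau>"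
  defines "m \<equiv> \<Sum>z\<in>{0..n}. g z * pmf \<pi> z"
  shows "(\<Sum>z\<in>{0..n}. pmf \<pi> z * exp (\<tau> * (g z - m))) \<le> exp (V / (2 * \<rho>) * exp_excess (\<tau> * r))"
proof -
  have sum_pmf: "(\<Sum>x\<in>{0..n}. pmf \<pi> x) = 1"
    using st by (intro sum_pmf_eq_1) (auto simp: stationary_distribution_def)
  have "(\<Sum>z\<in>{0..n}. pmf \<pi> z * exp (\<tau> * (g z - m)))
      \<le> exp (variance_factor t * exp_excess (\<tau> * r) + \<tau> * (real n * (exp (- \<rho> * t) * r)))"
    (is "?lhs \<le> exp ?b") if t: "0 < t" for t
  proof -
    have m: "m = (\<Sum>x\<in>{0..n}. pmf \<pi> x * semigroup t g x)"
      using stationary_sum_semigroup[OF st, of t g] t by (simp add: m_def mult.commute)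
    have lip: "lip_steps n (semigroup t g) (exp (- \<rho> * t) * r)"
      by (rule lip_contraction[OF g t])
    have mean: "semigroup t g x - m \<le> real n * (exp (- \<rho> * t) * r)" if x: "x \<in> {0..n}" for x
    proof -
      have "semigroup t g x - m = (\<Sum>y\<in>{0..n}. pmf \<pi> y * (semigroup t g x - semigroup t g y))"
        by (simp add: m right_diff_distrib sum_subtractf sum_pmf flip: sum_distrib_right)
      also have "\<dots> \<le> (\<Sum>y\<in>{0..n}. pmf \<pi> y * (real n * (exp (- \<rho> * t) * r)))"
        using lip_steps_dist[OF lip lip_steps_nonneg[OF lip]] x
        by (intro sum_mono mult_left_mono) (auto simp: abs_le_iff)
      also have "\<dots> = real n * (exp (- \<rho> * t) * r)"
        by (simp add: sum_pmf flip: sum_distrib_right)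
      finally show ?thesis .
    qed
    have "?lhs = (\<Sum>x\<in>{0..n}. pmf \<pi> x * semigroup t (\<lambda>z. exp (\<tau> * (g z - m))) x)"
      using stationary_sum_semigroup[OF st] t by simp
    also have "\<dots> \<le> (\<Sum>x\<in>{0..n}. pmf \<pi> x * exp ?b)"
    proof (intro sum_mono mult_left_mono)
      fix x assume x: "x \<in> {0..n}"
      have "lip_steps n (\<lambda>z. \<tau> * (g z - m)) (\<tau> * r)"
        using g \<open>0 < \<tau>\<close> by (intro lip_steps_cmult) (auto simp: lip_steps_def)
      from laplace[OF this t x]
      have "semigroup t (\<lambda>z. exp (\<tau> * (g z - m))) x
          \<le> exp (\<tau> * (semigroup t g x - m) + variance_factor t * exp_excess (\<tau> * r))"
        using x t by (simp add: semigroup_cmult semigroup_diff_const)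
      also have "\<dots> \<le> exp ?b"
        using mult_left_mono[OF mean[OF x], of \<tau>] \<open>0 < \<tau>\<close> by simp
      finally show "semigroup t (\<lambda>z. exp (\<tau> * (g z - m))) x \<le> exp ?b" .
    qed simp
    also have "\<dots> = exp ?b"
      by (simp add: sum_pmf flip: sum_distrib_right)
    finally show ?thesis .
  qed
  then have "\<forall>\<^sub>F t in at_top. (\<Sum>z\<in>{0..n}. pmf \<pi> z * exp (\<tau> * (g z - m)))
      \<le> exp (variance_factor t * exp_excess (\<tau> * r) + \<tau> * (real n * (exp (- \<rho> * t) * r)))"
    by (rule eventually_mono[OF eventually_gt_at_top[of 0]])
  moreover have "((\<lambda>t. exp (variance_factor t * exp_excess (\<tau> * r)
      + \<tau> * (real n * (exp (- \<rho> * t) * r))))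
      \<longlongrightarrow> exp (V * (1 - 0) / (2 * \<rho>) * exp_excess (\<tau> * r) + \<tau> * (real n * (0 * r)))) at_top"
  proof -
    have "((\<lambda>t. exp (- c * t)) \<longlongrightarrow> 0) at_top" if "0 < c" for c :: real
      using that by real_asymp
    from this[of \<rho>] this[of "2 * \<rho>"] show ?thesis
      unfolding variance_factor_def using curvature_pos by (intro tendsto_intros) auto
  qed
  ultimately show ?thesis
    using tendsto_lowerbound by fastforce
qed

end

section \<open>Tail bounds for the process and its stationary distribution\<close>

text \<open>For zero Lipschitz norm, division by zero would turn the exponential into 1; the value 0
  is the meaningful bound, as \<open>f\<close> is then constant on the states. The condition
  \<open>n \<ge> 2\<close> makes the range of the minimum nonempty.\<close>

theorem corollary4p10:
  fixes n :: nat
    and birth death :: "nat \<Rightarrow> real"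
    and M :: "'a measure"
    and P :: "nat \<Rightarrow> 'a measure"
    and X :: "real \<Rightarrow> 'a \<Rightarrow> nat"
    and \<pi> :: "nat pmf"
    and \<rho> :: real
    and f :: "nat \<Rightarrow> real"
  assumes "n \<ge> 2"
    and "birth_death_process n birth death M P X"
    and "stationary_distribution {0..n} P X \<pi>"
    and "\<rho> > 0"
    and "Min ((\<lambda>x. min (birth (x - 1) - birth x) (death (x + 1) - death x)) ` {1..n-1}) \<ge> \<rho>"
    and "f \<in> Lip_on {0..n}"
  shows "(\<forall>x\<in>{0..n}. \<forall>t>0. \<forall>y>0.
            \<P>(\<omega> in P x. f (X t \<omega>) - (\<integral>\<omega>'. f (X t \<omega>') \<partial>P x) \<ge> y)
              \<le> (if Lip_norm {0..n} f = 0 then 0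
                 else exp (- (y / (2 * Lip_norm {0..n} f)) *
                   ln (1 + 2 * \<rho> * y /
                     ((1 - exp (- 2 * \<rho> * t)) * (birth 0 + death n) * Lip_norm {0..n} f)))))
       \<and> (\<forall>y>0.
            measure_pmf.prob \<pi> {x \<in> {0..n}. f x - (\<Sum>z\<in>{0..n}. f z * pmf \<pi> z) \<ge> y}
              \<le> (if Lip_norm {0..n} f = 0 then 0
                 else exp (- (y / (2 * Lip_norm {0..n} f)) *
                   ln (1 + 2 * \<rho> * y / ((birth 0 + death n) * Lip_norm {0..n} f)))))"
proof -
  interpret birth_death_process n birth death M P X
    by (rule assms(2))
  define l where "l = Lip_norm {0..n} f"
  \<comment> \<open>Reading the hypothesis at \<open>Suc x\<close> removes the truncated
    subtraction. It covers neither the last step of the birth rates nor the first step of the death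
    rates.\<close>
  have rates: "birth (Suc x) + \<rho> \<le> birth x" "death (Suc x) + \<rho> \<le> death (Suc (Suc x))"
    if "Suc x < n" for x
  proof -
    have "Suc x \<in> {1..n-1}"
      using that by auto
    then have "Min ((\<lambda>x. min (birth (x - 1) - birth x) (death (x + 1) - death x)) ` {1..n-1})
        \<le> min (birth (Suc x - 1) - birth (Suc x)) (death (Suc x + 1) - death (Suc x))"
      by (rule Min_le[OF finite_imageI[OF finite_atLeastAtMost] imageI])
    with assms(5) have "\<rho> \<le> min (birth (Suc x - 1) - birth (Suc x)) (death (Suc x + 1) - death (Suc x))"
      by (rule order_trans)
    then show "birth (Suc x) + \<rho> \<le> birth x" "death (Suc x) + \<rho> \<le> death (Suc (Suc x))"
      by auto
  qed
  have birth_le: "birth x \<le> birth 0" if "x < n" for x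
    using that
  proof (induction x)
    case (Suc x)
    then show ?case
      using rates(1)[of x] assms(4) by simp
  qed simp
  \<comment> \<open>Counting down from \<open>n\<close> keeps the induction on states at least 1,
    where the increments are controlled.\<close>
  have death_le: "death (n - k) \<le> death n" if "k < n" for k
    using that
  proof (induction k)
    case (Suc k)
    moreover have "Suc (n - Suc (Suc k)) = n - Suc k" "Suc (n - Suc k) = n - k"
      "Suc (n - Suc (Suc k)) < n"
      using Suc.prems by auto
    ultimately show ?case
      using rates(2)[of "n - Suc (Suc k)"] assms(4) by simp
  qed simp
  interpret curved_birth_death n birth death M P X \<rho> "birth 0 + death n"
  proof
    show "0 < n" "0 < \<rho>"
      using assms by auto
    show "birth (Suc x) + death x + \<rho> \<le> birth x + death (Suc x)" if x: "x < n" for x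
    proof -
      \<comment> \<open>At either end one rate difference is at least \<open>\<rho>\<close> and the
        other is positive by the boundary values \<open>death 0 = 0\<close> and
        \<open>birth n = 0\<close>; in between both are at least \<open>\<rho>\<close>.\<close>
      consider "x = 0" | "x = n - 1" "x \<noteq> 0" | "0 < x" "Suc x < n"
        using x by linarith
      then show ?thesis
      proof cases
        case 1
        then show ?thesis
          using rates(1)[of 0] death_pos[of 1] death_bot assms(1) by simp
      next
        case 2
        then have "Suc x = n" "Suc (x - 1) = x"
          using x by auto
        then show ?thesis
          using rates(2)[of "x - 1"] birth_pos[of x] birth_top x by simp
      next
        case 3
        then show ?thesis
          using rates(1)[of x] rates(2)[of "x - 1"] assms(4) by simp
      qed
    qed
    show "birth x + death x \<le> birth 0 + death n" if "x \<le> n" for x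
    proof (rule add_mono)
      show "birth x \<le> birth 0"
        using birth_le[of x] birth_top birth_nonneg[of 0] that by (cases "x = n") auto
      show "death x \<le> death n"
        using death_le[of "n - x"] death_bot death_nonneg[of n] that by (cases "x = 0") auto
    qed
  qed
  have lip: "lip_steps n f l"
    unfolding l_def by (rule lip_steps_Lip_norm[OF assms(6)])
  have l: "0 \<le> l"
    by (rule lip_steps_nonneg[OF lip])
  obtain c where const: "f z = c" if "l = 0" "z \<in> {0..n}" for z
    using lip_steps_dist[OF lip l, of 0] by (metis abs_le_zero_iff atLeastAtMost_iff eq_iff_diff_eq_0
      mult_zero_right zero_le)
  have sum_pmf: "(\<Sum>x\<in>{0..n}. pmf \<pi> x) = 1"
    using assms(3) by (intro sum_pmf_eq_1) (auto simp: stationary_distribution_def)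
  show ?thesis
    unfolding l_def[symmetric]
  proof (intro conjI ballI allI impI)
    fix x :: nat and t y :: real
    assume x: "x \<in> {0..n}" and t: "0 < t" and y: "0 < y"
    have prob: "\<P>(\<omega> in P x. y \<le> f (X t \<omega>) - (\<integral>\<omega>'. f (X t \<omega>') \<partial>P x))
        = sum (trans t x) {z \<in> {0..n}. y \<le> f z - semigroup t f x}"
      using x t prob_eq_sum_trans[of x t "\<lambda>z. y \<le> f z - semigroup t f x"]
      by (simp add: expectation_eq_semigroup)
    show "\<P>(\<omega> in P x. y \<le> f (X t \<omega>) - (\<integral>\<omega>'. f (X t \<omega>') \<partial>P x))
      \<le> (if l = 0 then 0 else exp (- (y / (2 * l)) *
          ln (1 + 2 * \<rho> * y / ((1 - exp (- 2 * \<rho> * t)) * (birth 0 + death n) * l))))"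
    proof (cases "l = 0")
      case True
      have "semigroup t f x = c"
        using const[OF True] x t by (simp add: semigroup_def sum_trans flip: sum_distrib_right)
      then have "{z \<in> {0..n}. y \<le> f z - semigroup t f x} = {}"
        using const[OF True] y by auto
      then show ?thesis
        using True by (simp only: prob) simp
    next
      case False
      have "y / (variance_factor t * l)
          = 2 * \<rho> * y / ((1 - exp (- 2 * \<rho> * t)) * (birth 0 + death n) * l)"
        using assms(4) by (simp add: variance_factor_def field_simps)
      then show ?thesis
        unfolding prob
        using poisson_tail[OF _ _ variance_factor_pos[OF t], of "{0..n}" "trans t x" l y f
            "semigroup t f x"] laplace_centered[OF lip t x] trans_nonneg l False y
        by simp
    qed
  next
    fix y :: real assume y: "0 < y"
    define m where "m = (\<Sum>z\<in>{0..n}. f z * pmf \<pi> z)"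
    have prob: "measure_pmf.prob \<pi> {x \<in> {0..n}. y \<le> f x - m} = sum (pmf \<pi>) {x \<in> {0..n}. y \<le> f x - m}"
      by (rule measure_measure_pmf_finite) simp
    show "measure_pmf.prob \<pi> {x \<in> {0..n}. y \<le> f x - (\<Sum>z\<in>{0..n}. f z * pmf \<pi> z)}
      \<le> (if l = 0 then 0 else exp (- (y / (2 * l)) *
          ln (1 + 2 * \<rho> * y / ((birth 0 + death n) * l))))"
      unfolding m_def[symmetric]
    proof (cases "l = 0")
      case True
      have "m = c"
        using const[OF True] by (simp add: m_def sum_pmf flip: sum_distrib_left)
      then have "{x \<in> {0..n}. y \<le> f x - m} = {}"
        using const[OF True] y by auto
      then show "measure_pmf.prob \<pi> {x \<in> {0..n}. y \<le> f x - m} \<le> (if l = 0 then 0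
          else exp (- (y / (2 * l)) * ln (1 + 2 * \<rho> * y / ((birth 0 + death n) * l))))"
        using True by (simp only: prob) simp
    next
      case False
      \<comment> \<open>The Poisson mean for the stationary case: the limit of
        \<open>variance_factor t\<close>.\<close>
      have "0 < (birth 0 + death n) / (2 * \<rho>)"
        using V_pos assms(4) by simp
      from poisson_tail[OF _ _ this, of "{0..n}" "pmf \<pi>" l y f m]
      show "measure_pmf.prob \<pi> {x \<in> {0..n}. y \<le> f x - m} \<le> (if l = 0 then 0
          else exp (- (y / (2 * l)) * ln (1 + 2 * \<rho> * y / ((birth 0 + death n) * l))))"
        unfolding prob using laplace_stationary[OF assms(3) lip] l False y
        by (simp add: m_def mult_ac)
    qed
  qed
qed

end
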